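(* Let $I$ be a positive integer, let $\mathcal{P}=\mathcal{P}_1\times\dots\times\mathcal{P}_I$ where each $\mathcal{P}_i$ is a finite subset of $\mathbb{R}_+$, and let $\mathbf{u}=(\boldsymbol{\alpha},\boldsymbol{\beta},\boldsymbol{\gamma})$ with $\boldsymbol{\alpha},\boldsymbol{\beta}\in\mathbb{R}^I$ and $\boldsymbol{\gamma}=(\gamma_{i,j})_{i\ne j}\in\mathbb{R}^{I(I-1)}$. Let $$R(\mathbf{p},\mathbf{u}) = \sum_{i=1}^I p_i\, e^{\alpha_i-\beta_i \log p_i+\sum_{j\ne i}\gamma_{i,j}\log p_j}$$ be the log-log revenue function. Then $\max_{\mathbf{p}\in\mathcal{P}} \log R(\mathbf{p},\mathbf{u})$ equals the optimal objective value of the following mixed-integer convex program in the variables $\mu_i$ ($i\in[I]$), $w_{i,j,t}$ ($i,j\in[I]$, $t\in\mathcal{P}_j$), $x_{i,t}$ ($i\in[I]$, $t\in\mathcal{P}_i$): $$\text{maximize}\quad \sum_{i=1}^I \mu_i\alpha_i + \sum_{i=1}^I\sum_{t\in\mathcal{P}_i} \log t\cdot w_{i,i,t} - \sum_{i=1}^I \beta_i\sum_{t\in\mathcal{P}_i} \log t\cdot w_{i,i,t} + \sum_{i=1}^I\sum_{j\ne i}\gamma_{i,j}\sum_{t\in\mathcal{P}_j} \log t\cdot w_{i,j,t} - \sum_{i=1}^I \mu_i\log\mu_i$$ subject to $\sum_{t\in\mathcal{P}_j} w_{i,j,t}=\mu_i$ for all $i,j\in[I]$; $\sum_{i=1}^I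 w_{i,j,t}=x_{j,t}$ for all $j\in[I]$, $t\in\mathcal{P}_j$; $\sum_{i=1}^I\mu_i=1$; $\sum_{t\in\mathcal{P}_i}x_{i,t}=1$ for all $i\in[I]$; $w_{i,j,t}\ge 0$ for all $i,j\in[I]$, $t\in\mathcal{P}_j$; $x_{i,t}\in\{0,1\}$ for all $i\in[I]$, $t\in\mathcal{P}_i$; $\mu_i\ge0$ for all $i\in[I]$.
   Context: $[I]=\{1,\dots,I\}$, and $\mathbb{R}_+$ is the set of nonnegative real numbers. In the entropy term, $0\log 0$ is read as $0$, as usual. The set $\mathcal{P}$ is the set of feasible price vectors for $I$ products, and $x_{i,t}=1$ indicates that product $i$ is given price $t$.
   Formalization: Each price set is additionally assumed not to contain 0, because log p_i and log t in the revenue function and the program are undefined at price 0. *)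

theory Defs
  imports "HOL-Analysis.Analysis"
begin

text \<open>
  Products are indexed by \<open>{1..I}\<close>. Vectors are functions of which only the values on the relevant
  index sets are used; in particular the diagonal of \<open>\<gamma>\<close> never occurs.
\<close>

definition price_vectors :: "nat \<Rightarrow> (nat \<Rightarrow> real set) \<Rightarrow> (nat \<Rightarrow> real) set" where
  "price_vectors I P = PiE {1..I} P"

definition revenue ::
  "nat \<Rightarrow> (nat \<Rightarrow> real) \<Rightarrow> (nat \<Rightarrow> real) \<Rightarrow> (nat \<Rightarrow> nat \<Rightarrow> real) \<Rightarrow> (nat \<Rightarrow> real) \<Rightarrow> real" where
  "revenue I \<alpha> \<beta> \<gamma> p =
     (\<Sum>i\<in>{1..I}. p i * exp (\<alpha> i - \<beta> i * ln (p i) + (\<Sum>j\<in>{1..I} - {i}. \<gamma> i j * ln (p j))))"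

definition micp_feasible ::
  "nat \<Rightarrow> (nat \<Rightarrow> real set) \<Rightarrow>
   ((nat \<Rightarrow> real) \<times> (nat \<Rightarrow> nat \<Rightarrow> real \<Rightarrow> real) \<times> (nat \<Rightarrow> real \<Rightarrow> real)) set" where
  "micp_feasible I P = {(\<mu>, w, x).
     (\<forall>i\<in>{1..I}. \<forall>j\<in>{1..I}. (\<Sum>t\<in>P j. w i j t) = \<mu> i) \<and>
     (\<forall>j\<in>{1..I}. \<forall>t\<in>P j. (\<Sum>i\<in>{1..I}. w i j t) = x j t) \<and>
     (\<Sum>i\<in>{1..I}. \<mu> i) = 1 \<and>
     (\<forall>i\<in>{1..I}. (\<Sum>t\<in>P i. x i t) = 1) \<and>
     (\<forall>i\<in>{1..I}. \<forall>j\<in>{1..I}. \<forall>t\<in>P j. 0 \<le> w i j t) \<and>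
     (\<forall>i\<in>{1..I}. \<forall>t\<in>P i. x i t \<in> {0, 1}) \<and>
     (\<forall>i\<in>{1..I}. 0 \<le> \<mu> i)}"

text \<open>The entropy convention \<open>0 log 0 = 0\<close> holds automatically for the product \<open>\<mu> i * ln (\<mu> i)\<close>.\<close>

definition micp_objective ::
  "nat \<Rightarrow> (nat \<Rightarrow> real set) \<Rightarrow> (nat \<Rightarrow> real) \<Rightarrow> (nat \<Rightarrow> real) \<Rightarrow> (nat \<Rightarrow> nat \<Rightarrow> real) \<Rightarrow>
   ((nat \<Rightarrow> real) \<times> (nat \<Rightarrow> nat \<Rightarrow> real \<Rightarrow> real) \<times> (nat \<Rightarrow> real \<Rightarrow> real)) \<Rightarrow> real" where
  "micp_objective I P \<alpha> \<beta> \<gamma> = (\<lambda>(\<mu>, w, x).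
     (\<Sum>i\<in>{1..I}. \<mu> i * \<alpha> i)
     + (\<Sum>i\<in>{1..I}. \<Sum>t\<in>P i. ln t * w i i t)
     - (\<Sum>i\<in>{1..I}. \<beta> i * (\<Sum>t\<in>P i. ln t * w i i t))
     + (\<Sum>i\<in>{1..I}. \<Sum>j\<in>{1..I} - {i}. \<gamma> i j * (\<Sum>t\<in>P j. ln t * w i j t))
     - (\<Sum>i\<in>{1..I}. \<mu> i * ln (\<mu> i)))"

end

theory Submission
  imports Defs
begin

text \<open>
  The revenue is a sum of exponentials \<open>\<Sum>i. exp (e i)\<close>, so by the Gibbs variational principle
  its logarithm is the maximum of \<open>\<Sum>i. \<mu> i * e i - \<mu> i * ln (\<mu> i)\<close> over the probability simplex,
  attained at the softmax weights: the gap is the relative entropy with respect to them. A binary \<open>x\<close> selects one price \<open>p j\<close> for each product, and the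
  linking constraints then force \<open>w i j t\<close> to be \<open>\<mu> i\<close> for \<open>t = p j\<close> and \<open>0\<close> otherwise. Hence the
  objective of the program is exactly the Gibbs functional of \<open>\<mu>\<close> at the price vector \<open>p\<close>.
\<close>

definition probability_simplex :: "'a set \<Rightarrow> ('a \<Rightarrow> real) set" where
  "probability_simplex A = {\<mu>. (\<forall>i\<in>A. 0 \<le> \<mu> i) \<and> sum \<mu> A = 1}"

definition gibbs_functional :: "'a set \<Rightarrow> ('a \<Rightarrow> real) \<Rightarrow> ('a \<Rightarrow> real) \<Rightarrow> real" where
  "gibbs_functional A e \<mu> = (\<Sum>i\<in>A. \<mu> i * (e i - ln (\<mu> i)))"

definition log_sum_exp :: "'a set \<Rightarrow> ('a \<Rightarrow> real) \<Rightarrow> real" where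
  "log_sum_exp A e = ln (\<Sum>i\<in>A. exp (e i))"

definition softmax :: "'a set \<Rightarrow> ('a \<Rightarrow> real) \<Rightarrow> 'a \<Rightarrow> real" where
  "softmax A e i = exp (e i) / (\<Sum>k\<in>A. exp (e k))"

definition relative_entropy :: "'a set \<Rightarrow> ('a \<Rightarrow> real) \<Rightarrow> ('a \<Rightarrow> real) \<Rightarrow> real" where
  "relative_entropy A \<mu> \<nu> = (\<Sum>i\<in>A. \<mu> i * (ln (\<mu> i) - ln (\<nu> i)))"

lemma diff_le_mult_ln_diff:
  fixes a b :: real
  assumes "0 \<le> a" and "0 < b"
  shows "a - b \<le> a * (ln a - ln b)"
proof (cases "a = 0")
  case True
  then show ?thesis
    using \<open>0 < b\<close> by simp
next
  case False
  then have "0 < a"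
    using \<open>0 \<le> a\<close> by simp
  then have "ln b - ln a = ln (b / a)"
    using \<open>0 < b\<close> by (simp add: ln_div)
  also have "\<dots> \<le> b / a - 1"
    using \<open>0 < a\<close> \<open>0 < b\<close> by (intro ln_le_minus_one) simp
  finally have "a * (ln b - ln a) \<le> a * (b / a - 1)"
    using \<open>0 \<le> a\<close> by (intro mult_left_mono)
  also have "\<dots> = b - a"
    using \<open>0 < a\<close> by (simp add: field_simps)
  finally show ?thesis
    by (simp add: right_diff_distrib)
qed

lemma gibbs_inequality:
  assumes "\<And>i. i \<in> A \<Longrightarrow> 0 \<le> \<mu> i" and "\<And>i. i \<in> A \<Longrightarrow> 0 < \<nu> i"
  shows "sum \<mu> A - sum \<nu> A \<le> relative_entropy A \<mu> \<nu>"
  unfolding relative_entropy_def sum_subtractf[symmetric]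
  by (intro sum_mono diff_le_mult_ln_diff assms)

lemma sum_exp_pos:
  fixes e :: "'a \<Rightarrow> real"
  assumes "finite A" and "A \<noteq> {}"
  shows "0 < (\<Sum>i\<in>A. exp (e i))"
  using assms by (intro sum_pos) auto

lemma softmax_pos:
  assumes "finite A" and "A \<noteq> {}"
  shows "0 < softmax A e i"
  using sum_exp_pos[OF assms, of e] by (simp add: softmax_def)

lemma softmax_in_probability_simplex:
  assumes "finite A" and "A \<noteq> {}"
  shows "softmax A e \<in> probability_simplex A"
proof -
  have "sum (softmax A e) A = 1"
    using sum_exp_pos[OF assms, of e] by (simp add: softmax_def flip: sum_divide_distrib)
  then show ?thesis
    using softmax_pos[OF assms] by (simp add: probability_simplex_def less_imp_le)
qed

lemma ln_softmax:
  assumes "finite A" and "A \<noteq> {}"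
  shows "ln (softmax A e i) = e i - log_sum_exp A e"
  using sum_exp_pos[OF assms, of e] by (simp add: softmax_def log_sum_exp_def ln_div)

lemma gibbs_functional_eq_log_sum_exp_minus_relative_entropy:
  assumes "finite A" and "A \<noteq> {}" and "sum \<mu> A = 1"
  shows "gibbs_functional A e \<mu> = log_sum_exp A e - relative_entropy A \<mu> (softmax A e)"
proof -
  have "relative_entropy A \<mu> (softmax A e) =
      (\<Sum>i\<in>A. \<mu> i * log_sum_exp A e - \<mu> i * (e i - ln (\<mu> i)))"
    by (simp add: relative_entropy_def ln_softmax[OF assms(1,2)] algebra_simps)
  also have "\<dots> = log_sum_exp A e - gibbs_functional A e \<mu>"
    using \<open>sum \<mu> A = 1\<close>
    by (simp add: gibbs_functional_def sum_subtractf flip: sum_distrib_right)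
  finally show ?thesis
    by simp
qed

lemma gibbs_functional_le_log_sum_exp:
  assumes "\<mu> \<in> probability_simplex A"
  shows "gibbs_functional A e \<mu> \<le> log_sum_exp A e"
proof -
  have \<mu>: "\<And>i. i \<in> A \<Longrightarrow> 0 \<le> \<mu> i" "sum \<mu> A = 1"
    using assms by (auto simp: probability_simplex_def)
  then have A: "finite A" "A \<noteq> {}"
    by (auto intro: ccontr)
  have "0 = sum \<mu> A - sum (softmax A e) A"
    using softmax_in_probability_simplex[OF A] \<mu>(2) by (simp add: probability_simplex_def)
  also have "\<dots> \<le> relative_entropy A \<mu> (softmax A e)"
    by (intro gibbs_inequality \<mu>(1) softmax_pos[OF A])
  finally show ?thesis
    using gibbs_functional_eq_log_sum_exp_minus_relative_entropy[OF A \<mu>(2)] by simp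
qed

lemma gibbs_functional_softmax:
  assumes "finite A" and "A \<noteq> {}"
  shows "gibbs_functional A e (softmax A e) = log_sum_exp A e"
proof -
  have "sum (softmax A e) A = 1"
    using softmax_in_probability_simplex[OF assms] by (simp add: probability_simplex_def)
  moreover have "relative_entropy A (softmax A e) (softmax A e) = 0"
    by (simp add: relative_entropy_def)
  ultimately show ?thesis
    using gibbs_functional_eq_log_sum_exp_minus_relative_entropy[OF assms] by simp
qed

lemma SUP_gibbs_functional:
  assumes "finite A" and "A \<noteq> {}"
  shows "(SUP \<mu>\<in>probability_simplex A. ereal (gibbs_functional A e \<mu>)) = ereal (log_sum_exp A e)"
proof (rule antisym)
  show "(SUP \<mu>\<in>probability_simplex A. ereal (gibbs_functional A e \<mu>)) \<le> ereal (log_sum_exp A e)"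
    by (intro SUP_least) (simp add: gibbs_functional_le_log_sum_exp)
  show "ereal (log_sum_exp A e) \<le> (SUP \<mu>\<in>probability_simplex A. ereal (gibbs_functional A e \<mu>))"
    by (rule SUP_upper2[OF softmax_in_probability_simplex[OF assms, of e]])
      (simp add: gibbs_functional_softmax[OF assms])
qed

definition log_revenue_term ::
  "nat \<Rightarrow> (nat \<Rightarrow> real) \<Rightarrow> (nat \<Rightarrow> real) \<Rightarrow> (nat \<Rightarrow> nat \<Rightarrow> real) \<Rightarrow> (nat \<Rightarrow> real) \<Rightarrow> nat \<Rightarrow> real" where
  "log_revenue_term I \<alpha> \<beta> \<gamma> p i =
     \<alpha> i + ln (p i) - \<beta> i * ln (p i) + (\<Sum>j\<in>{1..I} - {i}. \<gamma> i j * ln (p j))"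

lemma ln_revenue_eq_log_sum_exp:
  assumes "\<And>i. i \<in> {1..I} \<Longrightarrow> 0 < p i"
  shows "ln (revenue I \<alpha> \<beta> \<gamma> p) = log_sum_exp {1..I} (log_revenue_term I \<alpha> \<beta> \<gamma> p)"
proof -
  have "revenue I \<alpha> \<beta> \<gamma> p = (\<Sum>i\<in>{1..I}. exp (log_revenue_term I \<alpha> \<beta> \<gamma> p i))"
    unfolding revenue_def log_revenue_term_def
    using assms by (intro sum.cong) (auto simp: exp_add exp_diff)
  then show ?thesis
    by (simp add: log_sum_exp_def)
qed

lemma mem_price_vectorsD: "\<lbrakk>p \<in> price_vectors I P; i \<in> {1..I}\<rbrakk> \<Longrightarrow> p i \<in> P i"
  unfolding price_vectors_def by (rule PiE_mem)

lemma finite_price_vectors: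
  assumes "\<forall>i\<in>{1..I}. finite (P i)"
  shows "finite (price_vectors I P)"
  unfolding price_vectors_def using assms by (intro finite_PiE) auto

lemma binary_sum_eq_1_imp_indicator:
  fixes x :: "'a \<Rightarrow> 'b::semiring_char_0"
  assumes "finite A" and binary: "\<And>t. t \<in> A \<Longrightarrow> x t \<in> {0, 1}" and "sum x A = 1"
  shows "\<exists>a\<in>A. \<forall>t\<in>A. x t = of_bool (t = a)"
proof -
  have of_bool_x: "of_bool (x t = 1) = x t" if "t \<in> A" for t
    using binary[OF that] by auto
  have "of_nat (card {t \<in> A. x t = 1}) = (\<Sum>t\<in>A. of_bool (x t = 1) :: 'b)"
    using \<open>finite A\<close> by (simp add: Int_def)
  also have "\<dots> = sum x A"
    by (intro sum.cong refl of_bool_x)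
  finally have "card {t \<in> A. x t = 1} = 1"
    using \<open>sum x A = 1\<close> by simp
  then obtain a where "{t \<in> A. x t = 1} = {a}"
    by (rule card_1_singletonE)
  then have "a \<in> A" and x_eq_1_iff: "\<And>t. t \<in> A \<Longrightarrow> x t = 1 \<longleftrightarrow> t = a"
    by auto
  have "x t = of_bool (t = a)" if "t \<in> A" for t
    using of_bool_x[OF that] unfolding x_eq_1_iff[OF that] by (rule sym)
  with \<open>a \<in> A\<close> show ?thesis
    by blast
qed

lemma nonneg_single_column_eq_row_sum:
  fixes w :: "'a \<Rightarrow> 'b \<Rightarrow> 'c::ordered_comm_monoid_add"
  assumes "finite A" and "finite B" and "a \<in> B"
    and nonneg: "\<And>i t. \<lbrakk>i \<in> A; t \<in> B\<rbrakk> \<Longrightarrow> 0 \<le> w i t"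
    and column_sum: "\<And>t. \<lbrakk>t \<in> B; t \<noteq> a\<rbrakk> \<Longrightarrow> (\<Sum>i\<in>A. w i t) = 0"
    and "i \<in> A" and "t \<in> B"
  shows "w i t = (if t = a then \<Sum>s\<in>B. w i s else 0)"
proof -
  have zero: "w i s = 0" if "s \<in> B" "s \<noteq> a" for s
    using column_sum[OF that] \<open>finite A\<close> \<open>i \<in> A\<close> nonneg that
    by (simp add: sum_nonneg_eq_0_iff)
  then have "(\<Sum>s\<in>B. w i s) = (\<Sum>s\<in>{a}. w i s)"
    using \<open>finite B\<close> \<open>a \<in> B\<close> by (intro sum.mono_neutral_right) auto
  then show ?thesis
    using zero \<open>t \<in> B\<close> by simp
qed

definition selects_prices ::
  "nat \<Rightarrow> (nat \<Rightarrow> real set) \<Rightarrow> (nat \<Rightarrow> real) \<Rightarrow>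
   (nat \<Rightarrow> real) \<times> (nat \<Rightarrow> nat \<Rightarrow> real \<Rightarrow> real) \<times> (nat \<Rightarrow> real \<Rightarrow> real) \<Rightarrow> bool" where
  "selects_prices I P p = (\<lambda>(\<mu>, w, x). \<forall>j\<in>{1..I}. \<forall>t\<in>P j.
     x j t = of_bool (t = p j) \<and> (\<forall>i\<in>{1..I}. w i j t = (if t = p j then \<mu> i else 0)))"

lemma micp_feasible_imp_selects_prices:
  assumes fin: "\<forall>j\<in>{1..I}. finite (P j)" and feasible: "(\<mu>, w, x) \<in> micp_feasible I P"
  shows "\<exists>p\<in>price_vectors I P. selects_prices I P p (\<mu>, w, x)"
proof -
  have w_sum: "\<And>i j. \<lbrakk>i \<in> {1..I}; j \<in> {1..I}\<rbrakk> \<Longrightarrow> (\<Sum>t\<in>P j. w i j t) = \<mu> i"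
    and w_x: "\<And>j t. \<lbrakk>j \<in> {1..I}; t \<in> P j\<rbrakk> \<Longrightarrow> (\<Sum>i\<in>{1..I}. w i j t) = x j t"
    and x_sum: "\<And>j. j \<in> {1..I} \<Longrightarrow> (\<Sum>t\<in>P j. x j t) = 1"
    and w_nonneg: "\<And>i j t. \<lbrakk>i \<in> {1..I}; j \<in> {1..I}; t \<in> P j\<rbrakk> \<Longrightarrow> 0 \<le> w i j t"
    and x_binary: "\<And>j t. \<lbrakk>j \<in> {1..I}; t \<in> P j\<rbrakk> \<Longrightarrow> x j t \<in> {0, 1}"
    using feasible unfolding micp_feasible_def by blast+
  have "\<forall>j\<in>{1..I}. \<exists>a\<in>P j. \<forall>t\<in>P j. x j t = of_bool (t = a)"
    using fin x_binary x_sum by (intro ballI binary_sum_eq_1_imp_indicator) auto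
  from bchoice[OF this[unfolded Bex_def]]
  obtain q where q: "\<forall>j\<in>{1..I}. q j \<in> P j \<and> (\<forall>t\<in>P j. x j t = of_bool (t = q j))"
    by blast
  have "w i j t = (if t = q j then \<mu> i else 0)"
    if "i \<in> {1..I}" "j \<in> {1..I}" "t \<in> P j" for i j t
  proof -
    have column_sum: "(\<Sum>i\<in>{1..I}. w i j s) = 0" if "s \<in> P j" "s \<noteq> q j" for s
      using w_x q \<open>j \<in> {1..I}\<close> that by simp
    have "w i j t = (if t = q j then \<Sum>s\<in>P j. w i j s else 0)"
      by (rule nonneg_single_column_eq_row_sum[where w = "\<lambda>i. w i j", OF _ _ _ _ column_sum])
        (use that q fin in \<open>auto simp: w_nonneg\<close>)
    then show ?thesis
      using w_sum that by simp
  qed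
  then have "selects_prices I P (restrict q {1..I}) (\<mu>, w, x)"
    using q by (simp add: selects_prices_def)
  moreover have "restrict q {1..I} \<in> price_vectors I P"
    using q by (auto simp: price_vectors_def)
  ultimately show ?thesis
    by blast
qed

lemma selects_prices_imp_micp_feasible:
  assumes "\<forall>j\<in>{1..I}. finite (P j)" and "p \<in> price_vectors I P"
    and "\<mu> \<in> probability_simplex {1..I}" and "selects_prices I P p (\<mu>, w, x)"
  shows "(\<mu>, w, x) \<in> micp_feasible I P"
  using assms mem_price_vectorsD[OF assms(2)]
  by (simp add: micp_feasible_def selects_prices_def probability_simplex_def)

lemma micp_objective_selects_prices:
  assumes fin: "\<forall>j\<in>{1..I}. finite (P j)" and "p \<in> price_vectors I P"
    and selects: "selects_prices I P p (\<mu>, w, x)"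
  shows "micp_objective I P \<alpha> \<beta> \<gamma> (\<mu>, w, x) =
    gibbs_functional {1..I} (log_revenue_term I \<alpha> \<beta> \<gamma> p) \<mu>"
proof -
  have mean: "(\<Sum>t\<in>P j. ln t * w i j t) = ln (p j) * \<mu> i" if "i \<in> {1..I}" "j \<in> {1..I}" for i j
  proof -
    have "p j \<in> P j"
      using \<open>p \<in> price_vectors I P\<close> that(2) by (rule mem_price_vectorsD)
    moreover have "(\<Sum>t\<in>P j. ln t * w i j t) = (\<Sum>t\<in>P j. if t = p j then ln t * \<mu> i else 0)"
      using selects that by (intro sum.cong) (auto simp: selects_prices_def)
    ultimately show ?thesis
      using fin that(2) by simp
  qed
  have "micp_objective I P \<alpha> \<beta> \<gamma> (\<mu>, w, x) =
      (\<Sum>i\<in>{1..I}. \<mu> i * \<alpha> i) + (\<Sum>i\<in>{1..I}. ln (p i) * \<mu> i)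
      - (\<Sum>i\<in>{1..I}. \<beta> i * (ln (p i) * \<mu> i))
      + (\<Sum>i\<in>{1..I}. \<Sum>j\<in>{1..I} - {i}. \<gamma> i j * (ln (p j) * \<mu> i))
      - (\<Sum>i\<in>{1..I}. \<mu> i * ln (\<mu> i))"
    unfolding micp_objective_def prod.case
    by (intro arg_cong2[where f = "(+)"] arg_cong2[where f = "(-)"] sum.cong refl)
      (simp_all add: mean)
  also have "\<dots> = gibbs_functional {1..I} (log_revenue_term I \<alpha> \<beta> \<gamma> p) \<mu>"
    unfolding gibbs_functional_def log_revenue_term_def
    by (simp add: sum.distrib sum_subtractf sum_distrib_left algebra_simps)
  finally show ?thesis .
qed

lemma micp_objective_image_feasible:
  assumes fin: "\<forall>j\<in>{1..I}. finite (P j)"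
  shows "micp_objective I P \<alpha> \<beta> \<gamma> ` micp_feasible I P =
    (\<Union>p\<in>price_vectors I P.
      gibbs_functional {1..I} (log_revenue_term I \<alpha> \<beta> \<gamma> p) ` probability_simplex {1..I})"
    (is "?values = (\<Union>p\<in>price_vectors I P. ?F p ` ?simplex)")
proof (intro equalityI subsetI)
  fix y assume "y \<in> ?values"
  then obtain \<mu> w x where feasible: "(\<mu>, w, x) \<in> micp_feasible I P"
    and y: "y = micp_objective I P \<alpha> \<beta> \<gamma> (\<mu>, w, x)"
    by auto
  obtain p where p: "p \<in> price_vectors I P" "selects_prices I P p (\<mu>, w, x)"
    using micp_feasible_imp_selects_prices[OF fin feasible] by blast
  have "\<mu> \<in> ?simplex"
    using feasible by (auto simp: micp_feasible_def probability_simplex_def)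
  moreover have "y = ?F p \<mu>"
    unfolding y by (rule micp_objective_selects_prices[OF fin p])
  ultimately show "y \<in> (\<Union>p\<in>price_vectors I P. ?F p ` ?simplex)"
    by (intro UN_I[OF p(1)] image_eqI)
next
  fix y assume "y \<in> (\<Union>p\<in>price_vectors I P. ?F p ` ?simplex)"
  then obtain p \<mu> where p: "p \<in> price_vectors I P" and \<mu>: "\<mu> \<in> ?simplex" and y: "y = ?F p \<mu>"
    by blast
  define z where "z = (\<mu>, \<lambda>i j t. if t = p j then \<mu> i else 0, \<lambda>j t. of_bool (t = p j) :: real)"
  have selects: "selects_prices I P p z"
    by (simp add: selects_prices_def z_def)
  have "z \<in> micp_feasible I P"
    using selects_prices_imp_micp_feasible[OF fin p \<mu>] selects unfolding z_def by blast
  moreover have "micp_objective I P \<alpha> \<beta> \<gamma> z = y"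
    using micp_objective_selects_prices[OF fin p] selects unfolding z_def y by blast
  ultimately show "y \<in> ?values"
    by blast
qed

lemma SUP_micp_objective:
  assumes "0 < I" and fin: "\<forall>j\<in>{1..I}. finite (P j)"
  shows "(SUP z\<in>micp_feasible I P. ereal (micp_objective I P \<alpha> \<beta> \<gamma> z)) =
    (SUP p\<in>price_vectors I P. ereal (log_sum_exp {1..I} (log_revenue_term I \<alpha> \<beta> \<gamma> p)))"
proof -
  have "(SUP z\<in>micp_feasible I P. ereal (micp_objective I P \<alpha> \<beta> \<gamma> z)) =
      (SUP y\<in>micp_objective I P \<alpha> \<beta> \<gamma> ` micp_feasible I P. ereal y)"
    by (simp add: image_image)
  also have "\<dots> = (SUP p\<in>price_vectors I P. SUP \<mu>\<in>probability_simplex {1..I}.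
      ereal (gibbs_functional {1..I} (log_revenue_term I \<alpha> \<beta> \<gamma> p) \<mu>))"
    unfolding micp_objective_image_feasible[OF fin] SUP_UNION by (simp add: image_image)
  also have "\<dots> =
      (SUP p\<in>price_vectors I P. ereal (log_sum_exp {1..I} (log_revenue_term I \<alpha> \<beta> \<gamma> p)))"
    using \<open>0 < I\<close> by (simp add: SUP_gibbs_functional)
  finally show ?thesis .
qed

lemma log_sum_exp_in_micp_objective_image:
  assumes "0 < I" and fin: "\<forall>j\<in>{1..I}. finite (P j)" and "p \<in> price_vectors I P"
  shows "log_sum_exp {1..I} (log_revenue_term I \<alpha> \<beta> \<gamma> p)
    \<in> micp_objective I P \<alpha> \<beta> \<gamma> ` micp_feasible I P"
  unfolding micp_objective_image_feasible[OF fin]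
proof (intro UN_I[OF \<open>p \<in> price_vectors I P\<close>] image_eqI)
  let ?e = "log_revenue_term I \<alpha> \<beta> \<gamma> p"
  show "log_sum_exp {1..I} ?e = gibbs_functional {1..I} ?e (softmax {1..I} ?e)"
    using \<open>0 < I\<close> by (simp add: gibbs_functional_softmax)
  show "softmax {1..I} ?e \<in> probability_simplex {1..I}"
    using \<open>0 < I\<close> by (intro softmax_in_probability_simplex) auto
qed

theorem mainTheorem9:
  fixes I :: nat and P :: "nat \<Rightarrow> real set"
    and \<alpha> \<beta> :: "nat \<Rightarrow> real" and \<gamma> :: "nat \<Rightarrow> nat \<Rightarrow> real"
  assumes "0 < I"
    and "\<And>i. i \<in> {1..I} \<Longrightarrow> finite (P i)"
    and "\<And>i. i \<in> {1..I} \<Longrightarrow> P i \<subseteq> {0..}"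
    and "\<And>i. i \<in> {1..I} \<Longrightarrow> 0 \<notin> P i"
  shows "(SUP p\<in>price_vectors I P. ereal (ln (revenue I \<alpha> \<beta> \<gamma> p))) =
           (SUP z\<in>micp_feasible I P. ereal (micp_objective I P \<alpha> \<beta> \<gamma> z))
       \<and> (price_vectors I P \<noteq> {} \<longrightarrow>
           (\<exists>z\<in>micp_feasible I P. micp_objective I P \<alpha> \<beta> \<gamma> z =
              Max ((\<lambda>p. ln (revenue I \<alpha> \<beta> \<gamma> p)) ` price_vectors I P)))"
    (is "(SUP p\<in>?prices. ereal (?L p)) = (SUP z\<in>?feasible. ereal (?objective z)) \<and> _")
proof (intro conjI impI)
  have fin: "\<forall>i\<in>{1..I}. finite (P i)"
    using assms(2) by blast
  have pos: "0 < p i" if "p \<in> ?prices" "i \<in> {1..I}" for p i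
    using mem_price_vectorsD[OF that] assms(3,4)[OF that(2)] by (force simp: less_le)
  have log_revenue: "?L p = log_sum_exp {1..I} (log_revenue_term I \<alpha> \<beta> \<gamma> p)" if "p \<in> ?prices" for p
    by (rule ln_revenue_eq_log_sum_exp[OF pos[OF that]])
  then show "(SUP p\<in>?prices. ereal (?L p)) = (SUP z\<in>?feasible. ereal (?objective z))"
    by (simp add: SUP_micp_objective[OF \<open>0 < I\<close> fin])
  assume "?prices \<noteq> {}"
  then have "Max (?L ` ?prices) \<in> ?L ` ?prices"
    using finite_price_vectors[OF fin] by (intro Max_in) auto
  also have "?L ` ?prices \<subseteq> ?objective ` ?feasible"
    using log_sum_exp_in_micp_objective_image[OF \<open>0 < I\<close> fin]
    by (simp add: image_subset_iff log_revenue)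
  finally show "\<exists>z\<in>?feasible. ?objective z = Max (?L ` ?prices)"
    by (metis (no_types, lifting) imageE)
qed

end
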